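(* Let $(X,\tau)$ be a metrizable countable-dimensional space. Then $1\leq \mathrm{Sn}^{\mathcal M_{\dim}}(X,\tau)\leq\aleph_0$.
   Context: Covering dimension: for a normal space $X$, $\dim X=-1$ iff $X=\emptyset$; $\dim X\le n$ ($n\ge 0$) if every finite open cover of $X$ has a finite open refinement covering $X$ in which any $n+2$ distinct elements have empty intersection; $\dim X=n$ if $\dim X\le n$ but not $\dim X\le n-1$; $\dim X=\infty$ if $\dim X\le n$ for no $n$. A metrizable space $X$ is countable-dimensional (in the sense of $\dim$) if it can be represented as the union of a sequence of subspaces $X_1,X_2,\dots$ with $\dim X_i\leq 0$ for $i=1,2,\dots$. $\mathcal M_{\dim}$ is the class of metrizable spaces $Z$ with $\dim Z=0$. Structural number: for a class $\mathcal A$ of topological spaces and a topological space $(X,\tau)$, $\mathrm{Sn}^{\mathcal A}(X,\tau)$ is the smallest cardinal number $\kappa$ for which there exists a family $\tau_i$, $i\in I$, of topologies on $X$ with $\tau\subseteq\tau_i$ and $(X,\tau_i)\in\mathcal A$ for all $i\in I$, such that $|I|=\kappa$ and $\tau=\bigcap_{i\in I}\tau_i$; if there is no such family, $\mathrm{Sn}^{\mathcal A}(X,\tau)=\infty$, where by convention $\infty>\kappa$ for every cardinal number $\kappa$. *)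

theory Defs
  imports "HOL-Analysis.Analysis"
begin

unbundle cardinal_syntax

section \<open>Covering dimension\<close>

text \<open>Not to be confused with the library's \<open>dimension_le\<close> (infix \<open>dim_le\<close>), which is the small
  inductive dimension.\<close>

definition cover_refines :: "'a set set \<Rightarrow> 'a set set \<Rightarrow> bool" where
  "cover_refines \<V> \<U> \<longleftrightarrow> (\<forall>V\<in>\<V>. \<exists>U\<in>\<U>. V \<subseteq> U)"

definition finite_open_cover :: "'a topology \<Rightarrow> 'a set set \<Rightarrow> bool" where
  "finite_open_cover X \<U> \<longleftrightarrow> finite \<U> \<and> (\<forall>U\<in>\<U>. openin X U) \<and> \<Union>\<U> = topspace X"

definition covering_dim_le :: "'a topology \<Rightarrow> nat \<Rightarrow> bool" where
  "covering_dim_le X n \<longleftrightarrow>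
     (\<forall>\<U>. finite_open_cover X \<U> \<longrightarrow>
        (\<exists>\<V>. finite_open_cover X \<V> \<and> cover_refines \<V> \<U> \<and>
             (\<forall>\<W>. \<W> \<subseteq> \<V> \<and> card \<W> = n + 2 \<longrightarrow> \<Inter>\<W> = {})))"

text \<open>The value is meaningful for normal spaces only; below it is used for metrizable ones.\<close>

definition covering_dim :: "'a topology \<Rightarrow> ereal" where
  "covering_dim X =
     (if topspace X = {} then - 1
      else if \<exists>n. covering_dim_le X n then ereal (real (LEAST n. covering_dim_le X n))
      else \<infinity>)"

lemma covering_dim_le_mono:
  assumes "covering_dim_le X m" "m \<le> n"
  shows "covering_dim_le X n"
  unfolding covering_dim_le_def
proof (intro allI impI)
  fix \<U> assume "finite_open_cover X \<U>"
  then obtain \<V> where V: "finite_open_cover X \<V>" "cover_refines \<V> \<U>"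
    and I: "\<And>\<W>. \<W> \<subseteq> \<V> \<Longrightarrow> card \<W> = m + 2 \<Longrightarrow> \<Inter>\<W> = {}"
    using assms(1)[unfolded covering_dim_le_def, rule_format, OF \<open>finite_open_cover X \<U>\<close>] by blast
  have "\<Inter>\<W> = {}" if W: "\<W> \<subseteq> \<V>" "card \<W> = n + 2" for \<W>
  proof -
    obtain \<W>' where "\<W>' \<subseteq> \<W>" "card \<W>' = m + 2"
      using obtain_subset_with_card_n[of "m + 2" \<W>] W(2) assms(2) by auto
    then show ?thesis using I[of \<W>'] W(1) by blast
  qed
  then show "\<exists>\<V>. finite_open_cover X \<V> \<and> cover_refines \<V> \<U> \<and>
      (\<forall>\<W>. \<W> \<subseteq> \<V> \<and> card \<W> = n + 2 \<longrightarrow> \<Inter>\<W> = {})"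
    using V by blast
qed

lemma covering_dim_le_empty:
  assumes "topspace X = {}"
  shows "covering_dim_le X n"
  unfolding covering_dim_le_def
proof (intro allI impI)
  fix \<U> :: "'a set set"
  show "\<exists>\<V>. finite_open_cover X \<V> \<and> cover_refines \<V> \<U> \<and>
      (\<forall>\<W>. \<W> \<subseteq> \<V> \<and> card \<W> = n + 2 \<longrightarrow> \<Inter>\<W> = {})"
    by (rule exI[of _ "{}"]) (auto simp: finite_open_cover_def cover_refines_def assms)
qed

lemma covering_dim_eq_minus_one_iff: "covering_dim X = - 1 \<longleftrightarrow> topspace X = {}"
  by (auto simp: covering_dim_def one_ereal_def)

lemma covering_dim_le_iff: "covering_dim X \<le> ereal (real n) \<longleftrightarrow> covering_dim_le X n"
proof (cases "topspace X = {}")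
  case True
  then show ?thesis
    by (simp add: covering_dim_def covering_dim_le_empty one_ereal_def)
next
  case False
  show ?thesis
  proof (cases "\<exists>n. covering_dim_le X n")
    case True
    then have "covering_dim_le X (LEAST n. covering_dim_le X n)" by (rule LeastI_ex)
    then show ?thesis
      using False True by (auto simp: covering_dim_def intro: Least_le covering_dim_le_mono)
  next
    case no_bound: False
    then have "covering_dim X = \<infinity>" using False by (simp only: covering_dim_def if_False)
    then show ?thesis using no_bound by simp
  qed
qed

definition countable_dimensional :: "'a topology \<Rightarrow> bool" where
  "countable_dimensional X \<longleftrightarrow>
     metrizable_space X \<and>
     (\<exists>S :: nat \<Rightarrow> 'a set. topspace X = (\<Union>i. S i) \<and>
        (\<forall>i. covering_dim (subtopology X (S i)) \<le> 0))"

definition M_dim :: "'a topology set" where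
  "M_dim = {Z. metrizable_space Z \<and> covering_dim Z = 0}"


section \<open>Structural number\<close>

text \<open>A family of topologies whose intersection is taken is understood to be nonempty.\<close>

definition structural_family ::
    "'a topology set \<Rightarrow> 'a topology \<Rightarrow> 'i set \<Rightarrow> ('i \<Rightarrow> 'a topology) \<Rightarrow> bool" where
  "structural_family \<A> X I T \<longleftrightarrow>
     I \<noteq> {} \<and>
     (\<forall>i\<in>I. topspace (T i) = topspace X \<and> {U. openin X U} \<subseteq> {U. openin (T i) U} \<and> T i \<in> \<A>) \<and>
     {U. openin X U} = (\<Inter>i\<in>I. {U. openin (T i) U})"

text \<open>Cardinals are well-orders of minimal type, compared by \<open>\<le>o\<close>; \<open>None\<close> stands for \<open>\<infinity>\<close>.
  Index sets are taken in the type of topologies: this loses nothing, since any family may be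
  replaced by its range, whose cardinality is not larger (see \<open>Sn_least\<close>).\<close>

definition structural_cardinals :: "'a topology set \<Rightarrow> 'a topology \<Rightarrow> 'a topology rel set" where
  "structural_cardinals \<A> X =
     {|I| | I :: 'a topology set. \<exists>T. structural_family \<A> X I T}"

definition Sn :: "'a topology set \<Rightarrow> 'a topology \<Rightarrow> 'a topology rel option" where
  "Sn \<A> X =
     (if structural_cardinals \<A> X = {} then None
      else Some (SOME \<kappa>. \<kappa> \<in> structural_cardinals \<A> X \<and>
                         (\<forall>\<mu>\<in>structural_cardinals \<A> X. \<kappa> \<le>o \<mu>)))"

fun ext_card_le :: "'a rel option \<Rightarrow> 'b rel option \<Rightarrow> bool" (infix \<open>\<le>c\<close> 50) where
  "ext_card_le _ None \<longleftrightarrow> True"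
| "ext_card_le None (Some _) \<longleftrightarrow> False"
| "ext_card_le (Some \<kappa>) (Some \<mu>) \<longleftrightarrow> \<kappa> \<le>o \<mu>"

lemma Sn_attained:
  assumes "Sn \<A> X = Some \<kappa>"
  shows "\<kappa> \<in> structural_cardinals \<A> X" "\<And>\<mu>. \<mu> \<in> structural_cardinals \<A> X \<Longrightarrow> \<kappa> \<le>o \<mu>"
proof -
  let ?C = "structural_cardinals \<A> X"
  have ne: "?C \<noteq> {}" and k: "\<kappa> = (SOME \<kappa>. \<kappa> \<in> ?C \<and> (\<forall>\<mu>\<in>?C. \<kappa> \<le>o \<mu>))"
    using assms by (auto simp: Sn_def split: if_splits)
  have "\<exists>\<kappa>\<in>?C. \<forall>\<mu>\<in>?C. \<kappa> \<le>o \<mu>"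
    using ne by (rule exists_minim_Card_order)
      (auto simp: structural_cardinals_def card_of_Card_order)
  then have "\<exists>\<kappa>. \<kappa> \<in> ?C \<and> (\<forall>\<mu>\<in>?C. \<kappa> \<le>o \<mu>)" by blast
  from someI_ex[OF this] have "\<kappa> \<in> ?C \<and> (\<forall>\<mu>\<in>?C. \<kappa> \<le>o \<mu>)"
    unfolding k[symmetric] .
  then show "\<kappa> \<in> ?C" "\<And>\<mu>. \<mu> \<in> ?C \<Longrightarrow> \<kappa> \<le>o \<mu>" by auto
qed

lemma Sn_least:
  fixes I :: "'i set"
  assumes "structural_family \<A> X I T"
  shows "Sn \<A> X \<le>c Some |I|"
proof -
  have "structural_family \<A> X (T ` I) id"
    using assms unfolding structural_family_def by (simp, blast)
  then have mem: "|T ` I| \<in> structural_cardinals \<A> X"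
    unfolding structural_cardinals_def by (intro CollectI exI[of _ "T ` I"] conjI refl exI[of _ id])
  then have "structural_cardinals \<A> X \<noteq> {}" by blast
  then obtain \<kappa> where k: "Sn \<A> X = Some \<kappa>" by (simp add: Sn_def)
  have "\<kappa> \<le>o |T ` I|" using Sn_attained(2)[OF k mem] .
  then have "\<kappa> \<le>o |I|" by (rule ordLeq_transitive) (rule card_of_image)
  then show ?thesis by (simp add: k)
qed

end

theory Submission
  imports Defs
begin

text \<open>
  The lower bound holds because the families that the structural number counts are nonempty.

  For the upper bound, write \<open>X\<close> as the union of subspaces \<open>S i\<close> with \<open>dim (S i) \<le> 0\<close>. For each
  \<open>i\<close> there is a finer metrizable topology \<open>T i\<close> of dimension \<open>0\<close> in which the points of \<open>S i\<close> keep
  their old neighbourhoods (\<open>zero_dimensional_refinement\<close>). A set that is open in every \<open>T i\<close> is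
  then a neighbourhood, in the topology of \<open>X\<close>, of each of its points, because each point lies in
  some \<open>S i\<close>. Hence the intersection of the countably many topologies \<open>T i\<close> is the topology of \<open>X\<close>.

  To build \<open>T\<close> from a single \<open>S\<close>, choose for each \<open>n\<close> a disjoint family of open subsets of \<open>X\<close> of
  diameter less than \<open>1 / (n + 1)\<close> that covers \<open>S\<close>, and declare two points to be \<open>n\<close>-close if they
  are equal or if for each \<open>m \<le> n\<close> they lie in the same member of the \<open>m\<close>-th family. Disjointness
  makes \<open>n\<close>-closeness an equivalence relation, and such a decreasing sequence of equivalence
  relations defines an ultrametric. The smallness of the members makes its topology finer than that
  of \<open>X\<close>. The \<open>n\<close>-class of a point of \<open>S\<close> is a finite intersection of open sets of \<open>X\<close>, so
  nothing changes near \<open>S\<close>, whereas a point outside some family becomes isolated. An ultrametric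
  space has dimension at most \<open>0\<close> (\<open>topology_of_equivalences\<close>).

  The disjoint families come from \<open>zero_dim_disjoint_refinement\<close>: although \<open>dim S \<le> 0\<close> only speaks
  of finite covers, in a metrizable space it yields disjoint open refinements of arbitrary open
  covers. The passage from finite to infinite is Stone's theorem, in the weak form that every open
  cover has an open refinement which is a countable union of disjoint families.
\<close>

section \<open>Ultrametric topologies\<close>

text \<open>The distance of two points is \<open>1 / (k + 1)\<close>, where \<open>k\<close> is the first index of an equivalence
  that separates them; thus the classes are the balls. To refine a finite open cover by disjoint
  sets, consider for each point its largest ball that lies inside a member of the cover. Two such
  balls are disjoint or equal, so sending each ball to one member that contains it splits the space
  into disjoint open sets.\<close>

lemma topology_of_equivalences:
  fixes R :: "nat \<Rightarrow> 'a \<Rightarrow> 'a \<Rightarrow> bool"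
  assumes eq: "\<And>n. equivp (R n)"
    and dec: "\<And>m n x y. m \<le> n \<Longrightarrow> R n x y \<Longrightarrow> R m x y"
    and sep: "\<And>x y. x \<in> M \<Longrightarrow> y \<in> M \<Longrightarrow> x \<noteq> y \<Longrightarrow> \<exists>n. \<not> R n x y"
  obtains Y where "topspace Y = M" "metrizable_space Y" "covering_dim_le Y 0"
    and "\<And>U. openin Y U \<longleftrightarrow> U \<subseteq> M \<and> (\<forall>x\<in>U. \<exists>n. \<forall>y\<in>M. R n x y \<longrightarrow> y \<in> U)"
proof -
  have refl: "R n x x" for n x using eq by (meson equivp_reflp)
  have sym: "R n x y \<longleftrightarrow> R n y x" for n x y using eq by (meson equivp_symp)
  have tr: "R n x y \<Longrightarrow> R n y z \<Longrightarrow> R n x z" for n x y z using eq by (meson equivp_transp)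
  define d where
    "d x y = (if \<forall>n. R n x y then 0 else 1 / (1 + real (LEAST n. \<not> R n x y)))" for x y
  have less: "d x y < 1 / (1 + real n) \<longleftrightarrow> R n x y" for n x y
  proof (cases "\<forall>n. R n x y")
    case True
    then show ?thesis by (simp add: d_def)
  next
    case False
    define k where "k = (LEAST n. \<not> R n x y)"
    have k: "\<not> R k x y" using False LeastI_ex[of "\<lambda>n. \<not> R n x y"] unfolding k_def by blast
    have "R n x y \<longleftrightarrow> n < k"
    proof
      show "n < k" if "R n x y" using dec[OF _ that, of k] k by (meson not_le)
      show "R n x y" if "n < k" using not_less_Least[OF that[unfolded k_def]] by simp
    qed
    moreover have "d x y = 1 / (1 + real k)" using False by (simp add: d_def k_def)
    moreover have "1 / (1 + real k) < 1 / (1 + real n) \<longleftrightarrow> n < k" by (simp add: field_simps)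
    ultimately show ?thesis by simp
  qed
  have d0: "d x y \<ge> 0" for x y by (simp add: d_def)
  have ultra: "d x z \<le> max (d x y) (d y z)" for x y z
  proof (rule ccontr)
    assume "\<not> ?thesis"
    then have a: "d x y < d x z" "d y z < d x z" by auto
    then have "d x z \<noteq> 0" using d0[of x y] by linarith
    then have "\<not> (\<forall>n. R n x z)" unfolding d_def by presburger
    then obtain k where k: "d x z = 1 / (1 + real k)" unfolding d_def by (metis (no_types))
    with a less have "R k x y" "R k y z" by metis+
    then have "R k x z" by (rule tr)
    with less k show False by (metis less_irrefl)
  qed
  interpret Metric_space M d
  proof
    show "0 \<le> d x y" for x y by (rule d0)
    show "d x y = d y x" for x y using sym by (simp add: d_def)
    show "d x y = 0 \<longleftrightarrow> x = y" if "x \<in> M" "y \<in> M" for x y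
      using sep[OF that] refl by (auto simp: d_def add_nonneg_eq_0_iff)
    show "d x z \<le> d x y + d y z" for x y z using ultra[of x z y] d0[of x y] d0[of y z] by linarith
  qed
  have op: "openin mtopology U \<longleftrightarrow> U \<subseteq> M \<and> (\<forall>x\<in>U. \<exists>n. \<forall>y\<in>M. R n x y \<longrightarrow> y \<in> U)" for U
  proof -
    have "(\<exists>r>0. mball x r \<subseteq> U) \<longleftrightarrow> (\<exists>n. \<forall>y\<in>M. R n x y \<longrightarrow> y \<in> U)" if "x \<in> M" for x
    proof
      assume "\<exists>r>0. mball x r \<subseteq> U"
      then obtain r where r: "r > 0" "mball x r \<subseteq> U" by blast
      obtain n where "inverse (real (Suc n)) < r" using r(1) reals_Archimedean by blast
      then have n: "1 / (1 + real n) < r" by (simp add: inverse_eq_divide add.commute)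
      have "y \<in> U" if "y \<in> M" "R n x y" for y
        using that less[of x y n] n r(2) \<open>x \<in> M\<close> by (auto simp: subset_iff)
      then show "\<exists>n. \<forall>y\<in>M. R n x y \<longrightarrow> y \<in> U" by blast
    next
      assume "\<exists>n. \<forall>y\<in>M. R n x y \<longrightarrow> y \<in> U"
      then obtain n where "\<forall>y\<in>M. R n x y \<longrightarrow> y \<in> U" by blast
      then have "mball x (1 / (1 + real n)) \<subseteq> U" using less by auto
      then show "\<exists>r>0. mball x r \<subseteq> U" by (intro exI[of _ "1 / (1 + real n)"]) simp
    qed
    then show ?thesis unfolding openin_mtopology by blast
  qed
  have "covering_dim_le mtopology 0"
    unfolding covering_dim_le_def
  proof (intro allI impI)
    fix \<U> assume "finite_open_cover mtopology \<U>"
    then have fin: "finite \<U>" and oU: "\<And>U. U \<in> \<U> \<Longrightarrow> openin mtopology U" and cov: "\<Union>\<U> = M"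
      by (auto simp: finite_open_cover_def)
    define C where "C n x = {y \<in> M. R n x y}" for n x
    have C_eq: "C n y = C n x" if "R n x y" for n x y
      using that tr sym unfolding C_def by blast
    define good where "good x n \<longleftrightarrow> (\<exists>U\<in>\<U>. C n x \<subseteq> U)" for x n
    define N where "N x = (LEAST n. good x n)" for x
    define f where "f x = (SOME U. U \<in> \<U> \<and> C (N x) x \<subseteq> U)" for x
    have good: "good x (N x)" if "x \<in> M" for x
    proof -
      from that cov obtain U where U: "U \<in> \<U>" "x \<in> U" by blast
      then obtain n where "\<forall>y\<in>M. R n x y \<longrightarrow> y \<in> U" using oU op by blast
      then have "good x n" using U by (auto simp: good_def C_def)
      then show ?thesis unfolding N_def by (rule LeastI)
    qed
    have f: "f x \<in> \<U>" "C (N x) x \<subseteq> f x" if "x \<in> M" for x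
    proof -
      have "\<exists>U. U \<in> \<U> \<and> C (N x) x \<subseteq> U" using good[OF that] by (auto simp: good_def)
      from someI_ex[OF this] show "f x \<in> \<U>" "C (N x) x \<subseteq> f x" by (auto simp: f_def)
    qed
    \<comment> \<open>Points in the largest good ball around \<open>x\<close> have the same largest good ball.\<close>
    have same: "f y = f x" if "R (N x) x y" "x \<in> M" "y \<in> M" for x y
    proof -
      have iff: "good y n \<longleftrightarrow> good x n" if "n \<le> N x" for n
        using C_eq[OF dec[OF that \<open>R (N x) x y\<close>]] by (simp add: good_def)
      have "N y = N x"
        unfolding N_def[of y]
      proof (intro Least_equality)
        show "good y (N x)" using good[OF \<open>x \<in> M\<close>] iff[of "N x"] by simp
        show "N x \<le> n" if "good y n" for n
        proof (cases "n \<le> N x")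
          case True
          then show ?thesis using that iff[of n] unfolding N_def by (intro Least_le) simp
        qed simp
      qed
      then show ?thesis using C_eq[OF that(1)] by (simp add: f_def)
    qed
    define V where "V U = {x \<in> M. f x = U}" for U
    show "\<exists>\<V>. finite_open_cover mtopology \<V> \<and> cover_refines \<V> \<U> \<and>
            (\<forall>\<W>. \<W> \<subseteq> \<V> \<and> card \<W> = 0 + 2 \<longrightarrow> \<Inter>\<W> = {})"
    proof (intro exI[of _ "V ` \<U>"] conjI allI impI)
      have "openin mtopology (V U)" for U
        unfolding op using same by (fastforce simp: V_def)
      then show "finite_open_cover mtopology (V ` \<U>)"
        using fin f(1) by (auto simp: finite_open_cover_def V_def)
      have "V U \<subseteq> U" for U using f(2) refl by (auto simp: V_def C_def)
      then show "cover_refines (V ` \<U>) \<U>" by (auto simp: cover_refines_def)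
      fix \<W> assume W: "\<W> \<subseteq> V ` \<U> \<and> card \<W> = 0 + 2"
      then obtain A B where "\<W> = {A, B}" "A \<noteq> B" unfolding add_0 card_2_iff by blast
      then show "\<Inter>\<W> = {}" using W by (auto simp: V_def)
    qed
  qed
  then show thesis using that[OF topspace_mtopology metrizable_space_mtopology _ op] by blast
qed

section \<open>Disjoint refinements of arbitrary open covers\<close>

text \<open>Stone's construction. Well-order the cover and let \<open>E n U\<close> consist of the points for which \<open>U\<close>
  is the first member containing them and which lie at distance at least \<open>2 / (n + 1)\<close> from the
  complement of \<open>U\<close>. If \<open>U\<close> precedes \<open>V\<close>, the points of \<open>E n V\<close> are outside \<open>U\<close>, hence at
  least \<open>2 / (n + 1)\<close> away from those of \<open>E n U\<close>, and the balls of half that radius are disjoint.\<close>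

lemma sigma_disjoint_open_refinement:
  assumes "metrizable_space X" and op: "\<And>U. U \<in> \<U> \<Longrightarrow> openin X U" and cov: "\<Union>\<U> = topspace X"
  obtains \<D> :: "nat \<Rightarrow> 'a set set"
  where "\<And>n. pairwise disjnt (\<D> n)" "\<And>n D. D \<in> \<D> n \<Longrightarrow> openin X D"
    "\<And>n. cover_refines (\<D> n) \<U>" "(\<Union>n. \<Union>(\<D> n)) = topspace X"
proof -
  obtain M d where md: "Metric_space M d" and X: "X = Metric_space.mtopology M d"
    using assms(1) unfolding metrizable_space_def by blast
  interpret Metric_space M d by (rule md)
  obtain r :: "'a set rel" where r: "Well_order r" "Field r = UNIV" using well_ordering by metis
  have wf: "wf (r - Id)" using r(1) unfolding well_order_on_def by (rule conjunct2)
  have tot: "U \<noteq> V \<Longrightarrow> (U, V) \<in> r - Id \<or> (V, U) \<in> r - Id" for U V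
    using r(1) unfolding well_order_on_def linear_order_on_def total_on_def r(2) by blast
  define q where "q n = 1 / (1 + real n)" for n
  define E where "E n U = {z \<in> U. mball z (2 * q n) \<subseteq> U \<and> (\<forall>V\<in>\<U>. (V, U) \<in> r - Id \<longrightarrow> z \<notin> V)}" for n U
  define D where "D n U = (\<Union>z\<in>E n U. mball z (q n))" for n U
  have q: "q n > 0" for n by (simp add: q_def)
  have ordered: "disjnt (D n U) (D n V)" if "(U, V) \<in> r - Id" "U \<in> \<U>" for n U V
  proof (rule ccontr)
    assume "\<not> ?thesis"
    then obtain w z z' where z: "z \<in> E n U" "z' \<in> E n V" "w \<in> mball z (q n)" "w \<in> mball z' (q n)"
      by (auto simp: disjnt_iff D_def)
    then have "d z z' < 2 * q n" using triangle''[of z w z'] commute[of z' w] commute[of w z] by auto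
    then have "z' \<in> U" using z by (auto simp: E_def subset_iff)
    then show False using that z(2) by (auto simp: E_def)
  qed
  have dis: "disjnt (D n U) (D n V)" if "U \<noteq> V" "U \<in> \<U>" "V \<in> \<U>" for n U V
    using tot[OF that(1)] ordered that(2,3) by (meson disjnt_sym)
  have sub: "D n U \<subseteq> U" for n U
    using q[of n] by (fastforce simp: D_def E_def subset_iff)
  have covD: "\<exists>n. \<exists>U\<in>\<U>. x \<in> D n U" if x: "x \<in> topspace X" for x
  proof -
    obtain U0 where "U0 \<in> {U \<in> \<U>. x \<in> U}" using x cov by blast
    then obtain U where U: "U \<in> \<U>" "x \<in> U" and
      first: "\<And>V. (V, U) \<in> r - Id \<Longrightarrow> V \<notin> {U \<in> \<U>. x \<in> U}"
      using wfE_min[OF wf, of U0] by (metis (no_types, lifting) mem_Collect_eq)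
    obtain s where s: "s > 0" "mball x s \<subseteq> U" using op[OF U(1)] U(2) by (auto simp: X openin_mtopology)
    obtain n where "inverse (real (Suc n)) < s / 2" using s(1) reals_Archimedean by (meson half_gt_zero)
    then have "2 * q n \<le> s" by (simp add: q_def inverse_eq_divide add.commute)
    then have "mball x (2 * q n) \<subseteq> U" using s(2) mball_subset_concentric by blast
    then have "x \<in> E n U" using U first by (auto simp: E_def)
    then show ?thesis using U(1) q[of n] x unfolding D_def X
      by (intro exI[of _ n] bexI[of _ U] UN_I[of x]) auto
  qed
  show thesis
  proof (rule that[of "\<lambda>n. D n ` \<U>"])
    show "pairwise disjnt (D n ` \<U>)" for n
    proof (rule pairwiseI)
      fix A B assume "A \<in> D n ` \<U>" "B \<in> D n ` \<U>" "A \<noteq> B"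
      then obtain U V where "U \<in> \<U>" "V \<in> \<U>" "A = D n U" "B = D n V" "U \<noteq> V" by blast
      then show "disjnt A B" using dis by blast
    qed
    show oD: "openin X B" if "B \<in> D n ` \<U>" for n B using that by (auto simp: D_def X)
    show "cover_refines (D n ` \<U>) \<U>" for n using sub by (auto simp: cover_refines_def)
    have "\<Union>(D n ` \<U>) \<subseteq> topspace X" for n by (intro Union_least openin_subset oD)
    moreover have "topspace X \<subseteq> (\<Union>n. \<Union>(D n ` \<U>))" using covD by fast
    ultimately show "(\<Union>n. \<Union>(D n ` \<U>)) = topspace X" by (metis UN_least subset_antisym)
  qed
qed

text \<open>The cover by \<open>U\<close> and the complement of \<open>F\<close> has a finite open refinement by disjoint sets; its
  members that meet \<open>F\<close> have union \<open>C\<close>.\<close>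

lemma clopen_between:
  assumes dim: "covering_dim_le X 0" and F: "closedin X F" and U: "openin X U" and "F \<subseteq> U"
  obtains C where "openin X C" "closedin X C" "F \<subseteq> C" "C \<subseteq> U"
proof -
  have "finite_open_cover X {U, topspace X - F}"
    using assms openin_subset[OF U] by (auto simp: finite_open_cover_def)
  then obtain \<V> where V: "finite_open_cover X \<V>" "cover_refines \<V> {U, topspace X - F}"
    and I: "\<And>\<W>. \<W> \<subseteq> \<V> \<Longrightarrow> card \<W> = 2 \<Longrightarrow> \<Inter>\<W> = {}"
    using dim unfolding covering_dim_le_def by (metis add_0)
  have dis: "A \<inter> B = {}" if "A \<in> \<V>" "B \<in> \<V>" "A \<noteq> B" for A B
    using I[of "{A, B}"] that by auto
  define C where "C = \<Union>{V \<in> \<V>. V \<inter> F \<noteq> {}}"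
  have oC: "openin X C" using V(1) by (auto simp: C_def finite_open_cover_def)
  have "topspace X - C = \<Union>{V \<in> \<V>. V \<inter> F = {}}"
  proof -
    have cov: "\<Union>\<V> = topspace X" using V(1) by (simp add: finite_open_cover_def)
    have "x \<notin> C" if "x \<in> V" "V \<in> \<V>" "V \<inter> F = {}" for x V
    proof
      assume "x \<in> C"
      then obtain W where "W \<in> \<V>" "W \<inter> F \<noteq> {}" "x \<in> W" by (auto simp: C_def)
      with dis[of V W] that show False by auto
    qed
    then show ?thesis unfolding cov[symmetric] by (auto simp: C_def)
  qed
  then have "openin X (topspace X - C)" using V(1) by (auto simp: finite_open_cover_def)
  then have "closedin X C" using oC by (simp add: closedin_def openin_subset)
  moreover have "F \<subseteq> C" using V(1) closedin_subset[OF F] unfolding C_def finite_open_cover_def by blast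
  moreover have "C \<subseteq> U" using V(2) by (auto simp: C_def cover_refines_def)
  ultimately show thesis using oC that by blast
qed

lemma open_countable_union_clopen:
  assumes "metrizable_space X" "covering_dim_le X 0" "openin X U"
  obtains C :: "nat \<Rightarrow> 'a set"
  where "\<And>n. openin X (C n)" "\<And>n. closedin X (C n)" "(\<Union>n. C n) = U"
proof -
  obtain F :: "nat \<Rightarrow> 'a set" where F: "\<forall>n. closedin X (F n)" "(\<Union>n. F n) = U"
    using open_imp_fsigma_in[OF assms(1,3)] unfolding fsigma_in_ascending by (elim exE conjE)
  have "\<exists>C. openin X C \<and> closedin X C \<and> F n \<subseteq> C \<and> C \<subseteq> U" for n
  proof -
    have "F n \<subseteq> U" using F(2) by blast
    from clopen_between[OF assms(2) F(1)[rule_format] assms(3) this] show ?thesis by metis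
  qed
  then obtain C where "\<And>n. openin X (C n) \<and> closedin X (C n) \<and> F n \<subseteq> C n \<and> C n \<subseteq> U" by metis
  then show thesis using F(2) by (intro that[of C]) blast+
qed

text \<open>Cover the union of each family of Stone's refinement by countably many clopen sets and
  make the resulting sequence of clopen sets disjoint; all terms stay open. Each term lies inside
  the union of one disjoint family, so intersecting it with the members of that family keeps
  everything disjoint.\<close>

lemma zero_dim_disjoint_refinement:
  assumes "metrizable_space X" "covering_dim_le X 0"
    and "\<And>U. U \<in> \<U> \<Longrightarrow> openin X U" and "\<Union>\<U> = topspace X"
  obtains \<V> where "\<And>V. V \<in> \<V> \<Longrightarrow> openin X V" "pairwise disjnt \<V>" "\<Union>\<V> = topspace X"
    "cover_refines \<V> \<U>"
proof -
  obtain \<D> :: "nat \<Rightarrow> 'a set set"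
    where D: "\<And>n. pairwise disjnt (\<D> n)" "\<And>n D. D \<in> \<D> n \<Longrightarrow> openin X D"
      "\<And>n. cover_refines (\<D> n) \<U>" "(\<Union>n. \<Union>(\<D> n)) = topspace X"
    using sigma_disjoint_open_refinement[OF assms(1,3,4)] by blast
  have "\<exists>C :: nat \<Rightarrow> 'a set. (\<forall>k. openin X (C k) \<and> closedin X (C k)) \<and> (\<Union>k. C k) = \<Union>(\<D> n)" for n
    using open_countable_union_clopen[OF assms(1,2), of "\<Union>(\<D> n)"] D(2) by (metis openin_Union)
  then obtain C :: "nat \<Rightarrow> nat \<Rightarrow> 'a set"
    where C: "\<And>n k. openin X (C n k)" "\<And>n k. closedin X (C n k)" "\<And>n. (\<Union>k. C n k) = \<Union>(\<D> n)"
    by metis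
  define c where "c j = C (fst (prod_decode j)) (snd (prod_decode j))" for j
  define e where "e = disjointed c"
  have oe: "openin X (e j)" for j
    unfolding e_def disjointed_def c_def using C by (intro openin_diff closedin_Union) auto
  have sube: "e j \<subseteq> \<Union>(\<D> (fst (prod_decode j)))" for j
    using disjointed_subset[of c j] unfolding e_def c_def C(3)[symmetric] by blast
  have dise: "i \<noteq> j \<Longrightarrow> e i \<inter> e j = {}" for i j
    using disjoint_family_disjointed[of c] by (auto simp: e_def disjoint_family_on_def)
  have "(\<Union>j. c j) = (\<Union>n. \<Union>k. C n k)"
  proof (intro subset_antisym UN_least)
    fix n k
    have "c (prod_encode (n, k)) = C n k" by (simp add: c_def)
    then show "C n k \<subseteq> (\<Union>j. c j)" by (metis UN_upper UNIV_I)
  qed (auto simp: c_def)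
  then have "(\<Union>j. c j) = topspace X" unfolding C(3) D(4) .
  then have cove: "(\<Union>j. e j) = topspace X" by (simp add: e_def UN_disjointed_eq)
  show thesis
  proof (rule that[of "{e j \<inter> D | j D. D \<in> \<D> (fst (prod_decode j))}"])
    show "openin X V" if "V \<in> {e j \<inter> D | j D. D \<in> \<D> (fst (prod_decode j))}" for V
      using that oe D(2) by auto
    show "pairwise disjnt {e j \<inter> D | j D. D \<in> \<D> (fst (prod_decode j))}"
    proof (clarsimp simp: pairwise_def)
      fix i j A B
      assume *: "A \<in> \<D> (fst (prod_decode i))" "B \<in> \<D> (fst (prod_decode j))" "e i \<inter> A \<noteq> e j \<inter> B"
      show "disjnt (e i \<inter> A) (e j \<inter> B)"
      proof (cases "i = j")
        case True
        then have "disjnt A B" using * D(1) by (auto simp: pairwise_def)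
        then show ?thesis by (auto simp: disjnt_def)
      next
        case False
        then show ?thesis using dise by (auto simp: disjnt_def)
      qed
    qed
    have "\<Union>{e j \<inter> D | j D. D \<in> \<D> (fst (prod_decode j))} = (\<Union>j. e j \<inter> \<Union>(\<D> (fst (prod_decode j))))" by auto
    also have "\<dots> = (\<Union>j. e j)" using sube by (simp add: Int_absorb2)
    finally have "\<Union>{e j \<inter> D | j D. D \<in> \<D> (fst (prod_decode j))} = (\<Union>j. e j)" .
    then show "\<Union>{e j \<inter> D | j D. D \<in> \<D> (fst (prod_decode j))} = topspace X" using cove by simp
    show "cover_refines {e j \<inter> D | j D. D \<in> \<D> (fst (prod_decode j))} \<U>"
      unfolding cover_refines_def
    proof
      fix V assume "V \<in> {e j \<inter> D | j D. D \<in> \<D> (fst (prod_decode j))}"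
      then obtain j D where V: "V = e j \<inter> D" "D \<in> \<D> (fst (prod_decode j))" by blast
      then obtain U where "U \<in> \<U>" "D \<subseteq> U" using D(3) unfolding cover_refines_def by meson
      then show "\<exists>U\<in>\<U>. V \<subseteq> U" using V(1) by blast
    qed
  qed
qed

section \<open>Zero-dimensional refinements of the topology\<close>

text \<open>Disjoint relatively open subsets of \<open>S\<close> extend to disjoint open sets of the whole space: around
  each point take the ball of half the radius of a ball whose trace on \<open>S\<close> stays in the given set.
  Keeping the radii small keeps the diameters small.\<close>

lemma (in Metric_space) disjoint_small_open_cover:
  assumes "S \<subseteq> M" "covering_dim_le (subtopology mtopology S) 0" "\<epsilon> > 0"
  obtains \<P> where "\<And>P. P \<in> \<P> \<Longrightarrow> openin mtopology P" "pairwise disjnt \<P>" "S \<subseteq> \<Union>\<P>"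
    "\<And>P x y. P \<in> \<P> \<Longrightarrow> x \<in> P \<Longrightarrow> y \<in> P \<Longrightarrow> d x y < \<epsilon>"
proof -
  let ?Y = "subtopology mtopology S"
  have tS: "topspace ?Y = S" using assms(1) by auto
  have mY: "metrizable_space ?Y" by (simp add: metrizable_space_mtopology metrizable_space_subtopology)
  define \<U> where "\<U> = (\<lambda>x. S \<inter> mball x (\<epsilon> / 4)) ` S"
  have "\<And>U. U \<in> \<U> \<Longrightarrow> openin ?Y U" by (auto simp: \<U>_def openin_subtopology_Int2)
  moreover have "\<Union>\<U> = topspace ?Y" using assms(1,3) by (auto simp: \<U>_def)
  ultimately obtain \<V> where V: "\<And>V. V \<in> \<V> \<Longrightarrow> openin ?Y V" "pairwise disjnt \<V>" "\<Union>\<V> = S"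
    and ref: "cover_refines \<V> \<U>"
    using zero_dim_disjoint_refinement[OF mY assms(2)] tS by metis
  define Q where
    "Q V = \<Union>{mball x (r / 2) | x r. x \<in> V \<and> 0 < r \<and> r \<le> \<epsilon> / 4 \<and> mball x r \<inter> S \<subseteq> V}" for V
  have VS: "V \<subseteq> S" if "V \<in> \<V>" for V using V(3) that by blast
  have QI: "\<exists>x r. x \<in> V \<and> r \<le> \<epsilon> / 4 \<and> mball x r \<inter> S \<subseteq> V \<and> x \<in> M \<and> y \<in> M \<and> d x y < r / 2"
    if "y \<in> Q V" for y V using that unfolding Q_def by clarsimp blast
  show thesis
  proof (rule that[of "Q ` \<V>"])
    show "openin mtopology P" if "P \<in> Q ` \<V>" for P using that by (auto simp: Q_def)
    show "pairwise disjnt (Q ` \<V>)"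
    proof (clarsimp simp: pairwise_def)
      fix A B assume AB: "A \<in> \<V>" "B \<in> \<V>" "Q A \<noteq> Q B"
      then have dAB: "A \<inter> B = {}" using V(2) by (metis pairwise_def disjnt_def)
      show "disjnt (Q A) (Q B)"
      proof (rule ccontr)
        assume "\<not> disjnt (Q A) (Q B)"
        then obtain w where w: "w \<in> Q A" "w \<in> Q B" by (auto simp: disjnt_iff)
        obtain x r where x: "x \<in> A" "mball x r \<inter> S \<subseteq> A" "x \<in> M" "w \<in> M" "d x w < r / 2"
          using QI[OF w(1)] by blast
        obtain y s where y: "y \<in> B" "mball y s \<inter> S \<subseteq> B" "y \<in> M" "d y w < s / 2"
          using QI[OF w(2)] by blast
        have "d x y < max r s" using triangle'[of x w y] x y by (auto simp: max_def)
        then have "y \<in> mball x r \<or> x \<in> mball y s" using x y commute[of x y] by (auto simp: max_def split: if_splits)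
        then show False using x y VS AB dAB by blast
      qed
    qed
    show "S \<subseteq> \<Union>(Q ` \<V>)"
    proof
      fix x assume "x \<in> S"
      then obtain V where v: "V \<in> \<V>" "x \<in> V" using V(3) by blast
      obtain T where T: "openin mtopology T" "V = T \<inter> S" using V(1)[OF v(1)] by (auto simp: openin_subtopology)
      then obtain r where r: "r > 0" "mball x r \<subseteq> T" using v(2) by (auto simp: openin_mtopology)
      define s where "s = min r (\<epsilon> / 4)"
      have s: "0 < s" "s \<le> \<epsilon> / 4" "s \<le> r" using r(1) assms(3) by (auto simp: s_def)
      have "mball x s \<inter> S \<subseteq> V" using T(2) r(2) s(3) mball_subset_concentric by blast
      moreover have "x \<in> mball x (s / 2)" using s(1) \<open>x \<in> S\<close> assms(1) by auto
      ultimately have "x \<in> Q V" unfolding Q_def using v(2) s(1,2)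
        by (intro UnionI[of "mball x (s / 2)"] CollectI exI[of _ x] exI[of _ s]) simp_all
      then show "x \<in> \<Union>(Q ` \<V>)" using v by blast
    qed
    fix P x y assume "P \<in> Q ` \<V>" and xy: "x \<in> P" "y \<in> P"
    then obtain V where v: "V \<in> \<V>" "P = Q V" by blast
    obtain z where z: "z \<in> S" "V \<subseteq> mball z (\<epsilon> / 4)"
      using ref v(1) by (auto simp: cover_refines_def \<U>_def)
    have near: "d z w < \<epsilon> / 2 \<and> w \<in> M" if w: "w \<in> P" for w
    proof -
      obtain u r where u: "u \<in> V" "r \<le> \<epsilon> / 4" "u \<in> M" "w \<in> M" "d u w < r / 2"
        using QI[of w V] w unfolding v(2) by blast
      moreover have "d z u < \<epsilon> / 4" "z \<in> M" using z u(1) by auto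
      ultimately show ?thesis using triangle[of z u w] assms(3) by linarith
    qed
    show "d x y < \<epsilon>"
      using near[OF xy(1)] near[OF xy(2)] triangle''[of x z y] z(1) assms(1) by (smt (verit) subsetD field_sum_of_halves)
  qed
qed

text \<open>The relation \<open>R n\<close> below is \<open>n\<close>-closeness with respect to disjoint open families \<open>\<P> m\<close> of
  mesh less than \<open>1 / (m + 1)\<close>. Since \<open>S\<close> is covered by each \<open>\<P> m\<close>, the class of a point of
  \<open>S\<close> is the intersection of the members \<open>Q m\<close>, \<open>m \<le> n\<close>, that contain it, which is open in
  \<open>X\<close>. The disjunct \<open>x = y\<close> makes \<open>R n\<close> reflexive at the points that some family misses.\<close>

lemma zero_dimensional_refinement:
  assumes "metrizable_space X" "S \<subseteq> topspace X" "covering_dim_le (subtopology X S) 0"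
  obtains Y where "topspace Y = topspace X" "metrizable_space Y" "covering_dim_le Y 0"
    "\<And>U. openin X U \<Longrightarrow> openin Y U"
    "\<And>U x. openin Y U \<Longrightarrow> x \<in> U \<Longrightarrow> x \<in> S \<Longrightarrow> \<exists>V. openin X V \<and> x \<in> V \<and> V \<subseteq> U"
proof -
  obtain M d where md: "Metric_space M d" and X: "X = Metric_space.mtopology M d"
    using assms(1) unfolding metrizable_space_def by blast
  interpret Metric_space M d by (rule md)
  have "\<exists>\<P>. (\<forall>P\<in>\<P>. openin X P) \<and> pairwise disjnt \<P> \<and> S \<subseteq> \<Union>\<P> \<and>
          (\<forall>P\<in>\<P>. \<forall>x\<in>P. \<forall>y\<in>P. d x y < 1 / (1 + real n))" for n
  proof -
    have S: "S \<subseteq> M" "covering_dim_le (subtopology mtopology S) 0"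
      using assms(2,3) unfolding X topspace_mtopology by auto
    have "1 / (1 + real n) > 0" by simp
    then obtain \<P> where "\<And>P. P \<in> \<P> \<Longrightarrow> openin mtopology P" "pairwise disjnt \<P>" "S \<subseteq> \<Union>\<P>"
        "\<And>P x y. P \<in> \<P> \<Longrightarrow> x \<in> P \<Longrightarrow> y \<in> P \<Longrightarrow> d x y < 1 / (1 + real n)"
      using disjoint_small_open_cover[OF S] by metis
    then show ?thesis unfolding X by (intro exI[of _ \<P>] conjI ballI)
  qed
  then have "\<forall>n. \<exists>\<P>. (\<forall>P\<in>\<P>. openin X P) \<and> pairwise disjnt \<P> \<and> S \<subseteq> \<Union>\<P> \<and>
          (\<forall>P\<in>\<P>. \<forall>x\<in>P. \<forall>y\<in>P. d x y < 1 / (1 + real n))" ..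
  from choice[OF this] obtain \<P> where fam: "\<And>n. (\<forall>P\<in>\<P> n. openin X P) \<and> pairwise disjnt (\<P> n) \<and>
      S \<subseteq> \<Union>(\<P> n) \<and> (\<forall>P\<in>\<P> n. \<forall>x\<in>P. \<forall>y\<in>P. d x y < 1 / (1 + real n))"
    by blast
  have P: "openin X P" if "P \<in> \<P> n" for n P using fam[of n] that by simp
  have disP: "pairwise disjnt (\<P> n)" and covP: "S \<subseteq> \<Union>(\<P> n)" for n using fam[of n] by simp_all
  have small: "d x y < 1 / (1 + real n)" if "P \<in> \<P> n" "x \<in> P" "y \<in> P" for n P x y
    using fam[THEN conjunct2, THEN conjunct2, THEN conjunct2, rule_format, OF that] .
  define R where "R n x y \<longleftrightarrow> x = y \<or> (\<forall>m\<le>n. \<exists>P\<in>\<P> m. x \<in> P \<and> y \<in> P)" for n :: nat and x y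
  have small': "\<exists>n. \<forall>y. R n x y \<longrightarrow> x = y \<or> d x y < r" if r: "r > 0" for x r
  proof -
    obtain n where "inverse (real (Suc n)) < r" using r reals_Archimedean by blast
    then have "1 / (1 + real n) < r" by (simp add: inverse_eq_divide add.commute)
    moreover have "x = y \<or> d x y < 1 / (1 + real n)" if "R n x y" for y
      using that small unfolding R_def by blast
    ultimately show ?thesis by (intro exI[of _ n]) force
  qed
  have eq: "equivp (R n)" for n
  proof (rule equivpI)
    show "reflp (R n)" by (simp add: reflp_def R_def)
    show "symp (R n)" by (auto simp: symp_def R_def)
    have step: "\<exists>P\<in>\<P> m. x \<in> P \<and> z \<in> P"
      if "\<exists>P\<in>\<P> m. x \<in> P \<and> y \<in> P" "\<exists>P\<in>\<P> m. y \<in> P \<and> z \<in> P" for m x y z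
    proof -
      from that obtain P Q where "P \<in> \<P> m" "Q \<in> \<P> m" "x \<in> P" "y \<in> P" "y \<in> Q" "z \<in> Q" by blast
      moreover from this have "P = Q" using disP[of m] unfolding pairwise_def disjnt_iff by blast
      ultimately show ?thesis by blast
    qed
    show "transp (R n)"
    proof (rule transpI)
      fix x y z assume xy: "R n x y" and yz: "R n y z"
      show "R n x z"
      proof (cases "x = y \<or> y = z")
        case True
        then show ?thesis using xy yz by auto
      next
        case False
        then have "\<forall>m\<le>n. \<exists>P\<in>\<P> m. x \<in> P \<and> y \<in> P" "\<forall>m\<le>n. \<exists>P\<in>\<P> m. y \<in> P \<and> z \<in> P"
          using xy yz unfolding R_def by (simp_all only: de_Morgan_disj simp_thms)
        then show ?thesis unfolding R_def by (meson step)
      qed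
    qed
  qed
  have dec: "R m x y" if "m \<le> n" "R n x y" for m n x y
    using that unfolding R_def by (meson order_trans)
  have sep: "\<exists>n. \<not> R n x y" if "x \<in> M" "y \<in> M" "x \<noteq> y" for x y
    using small'[of "d x y" x] mdist_pos_less[OF that(3,1,2)] that(3) by blast
  obtain Y where Y: "topspace Y = M" "metrizable_space Y" "covering_dim_le Y 0"
    and op: "\<And>U. openin Y U \<longleftrightarrow> U \<subseteq> M \<and> (\<forall>x\<in>U. \<exists>n. \<forall>y\<in>M. R n x y \<longrightarrow> y \<in> U)"
    by (rule topology_of_equivalences[of R M]; (rule eq | rule dec, assumption+ | rule sep, assumption+)?) blast
  show thesis
  proof (rule that[of Y])
    show "topspace Y = topspace X" using Y X by simp
    show "metrizable_space Y" "covering_dim_le Y 0" by (rule Y)+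
  next
    fix U assume "openin X U"
    then have U: "U \<subseteq> M" "\<And>x. x \<in> U \<Longrightarrow> \<exists>r>0. mball x r \<subseteq> U" by (auto simp: X openin_mtopology)
    have "\<exists>n. \<forall>y\<in>M. R n x y \<longrightarrow> y \<in> U" if x: "x \<in> U" for x
    proof -
      obtain r where r: "r > 0" "mball x r \<subseteq> U" using U(2)[OF x] by blast
      obtain n where n: "\<And>y. R n x y \<Longrightarrow> x = y \<or> d x y < r" using small'[OF r(1)] by blast
      have "y \<in> U" if "y \<in> M" "R n x y" for y
      proof (cases "x = y")
        case False
        then have "y \<in> mball x r" using n[OF that(2)] that(1) x U(1) by auto
        then show ?thesis using r(2) by blast
      qed (use x in simp)
      then show ?thesis by blast
    qed
    then show "openin Y U" using U(1) op by blast
  next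
    fix U x assume U: "openin Y U" "x \<in> U" "x \<in> S"
    have "\<exists>n. \<forall>y\<in>M. R n x y \<longrightarrow> y \<in> U" using op[of U] U(1,2) by simp
    then obtain n where n: "\<forall>y\<in>M. R n x y \<longrightarrow> y \<in> U" ..
    have "\<exists>Q. Q \<in> \<P> m \<and> x \<in> Q" for m using covP[of m] U(3) by blast
    then obtain Q where Q: "\<And>m. Q m \<in> \<P> m" "\<And>m. x \<in> Q m" by metis
    define V where "V = (\<Inter>m\<le>n. Q m)"
    have oV: "openin X V" unfolding V_def using P[OF Q(1)] by (intro openin_INT2) simp_all
    have "R n x y" if "y \<in> V" for y
      unfolding R_def
    proof (intro disjI2 allI impI)
      fix m assume "m \<le> n"
      then have "y \<in> Q m" using that by (simp add: V_def)
      then show "\<exists>P\<in>\<P> m. x \<in> P \<and> y \<in> P" using Q by blast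
    qed
    moreover have "V \<subseteq> M" using openin_subset[OF oV] X by simp
    ultimately have "V \<subseteq> U" using n by blast
    moreover have "x \<in> V" using Q(2) by (simp add: V_def)
    ultimately show "\<exists>V. openin X V \<and> x \<in> V \<and> V \<subseteq> U" using oV by blast
  qed
qed

section \<open>Bounds for the structural number\<close>

lemma one_le_Sn: "Some cone \<le>c Sn \<A> X"
proof (cases "Sn \<A> X")
  case (Some \<kappa>)
  then have "\<kappa> \<in> structural_cardinals \<A> X" by (rule Sn_attained(1))
  then obtain I :: "'a topology set" where "I \<noteq> {}" "\<kappa> = |I|"
    by (auto simp: structural_cardinals_def structural_family_def)
  then have "cone \<le>o \<kappa>" unfolding BNF_Cardinal_Arithmetic.cone_def by (simp add: card_of_singl_ordLeq)
  then show ?thesis by (simp add: Some)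
qed simp

theorem theorem4p23:
  fixes X :: "'a topology"
  assumes "topspace X \<noteq> {}"
    and "metrizable_space X"
    and "countable_dimensional X"
  shows "Some cone \<le>c Sn M_dim X \<and> Sn M_dim X \<le>c Some natLeq"
proof
  show "Some cone \<le>c Sn M_dim X" by (rule one_le_Sn)
  obtain S :: "nat \<Rightarrow> 'a set" where S: "topspace X = (\<Union>i. S i)"
    and "\<And>i. covering_dim (subtopology X (S i)) \<le> 0"
    using assms(3) by (auto simp: countable_dimensional_def)
  then have dimS: "covering_dim_le (subtopology X (S i)) 0" for i
    using covering_dim_le_iff[of "subtopology X (S i)" 0] by (metis of_nat_0 zero_ereal_def)
  have "\<exists>Y. topspace Y = topspace X \<and> metrizable_space Y \<and> covering_dim_le Y 0 \<and>
          (\<forall>U. openin X U \<longrightarrow> openin Y U) \<and>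
          (\<forall>U x. openin Y U \<and> x \<in> U \<and> x \<in> S i \<longrightarrow> (\<exists>V. openin X V \<and> x \<in> V \<and> V \<subseteq> U))" for i
  proof -
    have "S i \<subseteq> topspace X" using S by blast
    from zero_dimensional_refinement[OF assms(2) this dimS] obtain Y where
      "topspace Y = topspace X" "metrizable_space Y" "covering_dim_le Y 0"
      "\<And>U. openin X U \<Longrightarrow> openin Y U"
      "\<And>U x. openin Y U \<Longrightarrow> x \<in> U \<Longrightarrow> x \<in> S i \<Longrightarrow> \<exists>V. openin X V \<and> x \<in> V \<and> V \<subseteq> U"
      by metis
    then show ?thesis by (intro exI[of _ Y]) simp
  qed
  then have "\<forall>i. \<exists>Y. topspace Y = topspace X \<and> metrizable_space Y \<and> covering_dim_le Y 0 \<and>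
          (\<forall>U. openin X U \<longrightarrow> openin Y U) \<and>
          (\<forall>U x. openin Y U \<and> x \<in> U \<and> x \<in> S i \<longrightarrow> (\<exists>V. openin X V \<and> x \<in> V \<and> V \<subseteq> U))" ..
  from choice[OF this] obtain T where T_all: "\<forall>i. topspace (T i) = topspace X \<and>
      metrizable_space (T i) \<and> covering_dim_le (T i) 0 \<and> (\<forall>U. openin X U \<longrightarrow> openin (T i) U) \<and>
      (\<forall>U x. openin (T i) U \<and> x \<in> U \<and> x \<in> S i \<longrightarrow> (\<exists>V. openin X V \<and> x \<in> V \<and> V \<subseteq> U))" ..
  have T: "topspace (T i) = topspace X" "metrizable_space (T i)" "covering_dim_le (T i) 0" for i
    using T_all[rule_format, of i] by simp_all
  have finer: "openin (T i) U" if "openin X U" for i U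
    using T_all[rule_format, of i] that by simp
  have nhd: "\<exists>V. openin X V \<and> x \<in> V \<and> V \<subseteq> U" if "openin (T i) U" "x \<in> U" "x \<in> S i" for i U x
    using T_all that by blast
  have "covering_dim (T i) = 0" for i
  proof -
    have "(LEAST n. covering_dim_le (T i) n) = 0" using T(3) by (simp add: Least_eq_0)
    then show ?thesis using assms(1) T(1,3)[of i] by (auto simp: covering_dim_def zero_ereal_def)
  qed
  then have mem: "T i \<in> M_dim" for i using T(2) by (simp add: M_dim_def)
  have int: "openin X U" if "\<And>i. openin (T i) U" for U
  proof -
    have "U \<subseteq> topspace X" using openin_subset[OF that] T(1) by simp
    then have "\<exists>V. openin X V \<and> x \<in> V \<and> V \<subseteq> U" if "x \<in> U" for x
      using that S nhd[OF \<open>\<And>i. openin (T i) U\<close>] by blast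
    then show ?thesis by (subst openin_subopen) blast
  qed
  have "structural_family M_dim X (UNIV :: nat set) T"
    unfolding structural_family_def using T(1) finer mem int by auto
  then have "Sn M_dim X \<le>c Some |UNIV :: nat set|" by (rule Sn_least)
  then show "Sn M_dim X \<le>c Some natLeq"
    by (cases "Sn M_dim X") (auto intro: ordLeq_ordIso_trans card_of_nat)
qed

end
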